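(* Let $M$ and $N$ be two quasianalytic weight sequences and assume $\sup_{k\in\mathbb N_{>0}}n_k^{1/k}=+\infty$ (i.e. $\mathcal O^{0,r}\subsetneq\mathcal E^{0,r}_{\{N\}}$). Then $\Lambda^r_{\{N\}}\setminus j^\infty(\mathcal E^{0,r}_{\{M\}})$ is dense in $\Lambda^r_{\{N\}}$ (and hence so is $\Lambda^r_{\{N\}}\setminus j^\infty(\mathcal E^{0,r}_{(M)})$).
   Context: For a sequence $M=(M_p)_{p\in\mathbb N}$ of positive reals write $m_p:=M_p/p!$ (and $n_p:=N_p/p!$). $M$ is a weight sequence if $1=M_0\le M_1$, $M_p^2\le M_{p-1}M_{p+1}$ for all $p\ge1$, and $\liminf_{p\to\infty}m_p^{1/p}>0$; it is quasianalytic if $\sum_{p\ge1}M_{p-1}/M_p=+\infty$. For $U\subseteq\mathbb R^r$ open, $K\subseteq U$ compact, $h>0$: $\|f\|^M_{K,h}:=\sup_{\alpha\in\mathbb N^r,x\in K}|\partial^\alpha f(x)|/(h^{|\alpha|}M_{|\alpha|})$. $\mathcal E_{\{M\}}(U)$ consists of smooth $f$ such that for every compact $K\subseteq U$ there exists $h>0$ with $\|f\|^M_{K,h}<\infty$; $\mathcal E_{(M)}(U)$: for every compact $K$ and every $h>0$. $\mathcal E^{0,r}_{\{M\}}$, $\mathcal E^{0,r}_{(M)}$ are the spaces of germs at $0\in\mathbb R^r$ of functions in the respective class on some cube $(-1/k,1/k)^r$; $\mathcal O^{0,r}$ denotes germs at $0$ of real analytic functions. For $\mathbf b=(b_\alpha)_{\alpha\in\mathbb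 N^r}$ and $h>0$: $|\mathbf b|^N_h:=\sup_\alpha|b_\alpha|/(h^{|\alpha|}n_{|\alpha|})$; $\Lambda^r_{\{N\}}:=\{\mathbf b:\exists h>0,|\mathbf b|^N_h<\infty\}$, endowed with the inductive limit topology of the Banach spaces $\{\mathbf b:|\mathbf b|^N_h<\infty\}$, $h>0$ (an (LB)-space). The Borel map is $j^\infty(f)=(\partial^\alpha f(0)/|\alpha|!)_{\alpha\in\mathbb N^r}$. *)

theory Defs
  imports "HOL-Analysis.Analysis" "HOL-Library.Liminf_Limsup"
begin

definition weight_seq :: "(nat \<Rightarrow> real) \<Rightarrow> bool" where
  "weight_seq M \<longleftrightarrow>
     (\<forall>p. M p > 0) \<and> M 0 = 1 \<and> M 0 \<le> M 1 \<and>
     (\<forall>p\<ge>1. (M p)\<^sup>2 \<le> M (p - 1) * M (p + 1)) \<and>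
     liminf (\<lambda>p. ereal (root p (M p / fact p))) > 0"

definition quasianalytic :: "(nat \<Rightarrow> real) \<Rightarrow> bool" where
  "quasianalytic M \<longleftrightarrow> \<not> summable (\<lambda>p. M p / M (Suc p))"

definition pd :: "'n::finite \<Rightarrow> (real^'n \<Rightarrow> real) \<Rightarrow> real^'n \<Rightarrow> real" where
  "pd i f x = deriv (\<lambda>t. f (x + t *\<^sub>R axis i 1)) 0"

fun pds :: "'n::finite list \<Rightarrow> (real^'n \<Rightarrow> real) \<Rightarrow> real^'n \<Rightarrow> real" where
  "pds [] f = f"
| "pds (i # is) f = pd i (pds is f)"

definition smooth_on :: "(real^'n::finite) set \<Rightarrow> (real^'n \<Rightarrow> real) \<Rightarrow> bool" where
  "smooth_on U f \<longleftrightarrow>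
     (\<forall>is. continuous_on U (pds is f) \<and>
        (\<forall>i. \<forall>x\<in>U. ((\<lambda>t. pds is f (x + t *\<^sub>R axis i 1)) has_real_derivative
                        pds (i # is) f x) (at 0)))"

text \<open>Multi-indices alpha : 'n => nat, length |alpha|, and the partial derivative of order alpha
  (the order of differentiation is irrelevant for smooth functions).\<close>
definition mlen :: "('n::finite \<Rightarrow> nat) \<Rightarrow> nat" where
  "mlen \<alpha> = (\<Sum>i\<in>UNIV. \<alpha> i)"

definition pdm :: "('n::finite \<Rightarrow> nat) \<Rightarrow> (real^'n \<Rightarrow> real) \<Rightarrow> real^'n \<Rightarrow> real" where
  "pdm \<alpha> f = pds (SOME xs. \<forall>i. count_list xs i = \<alpha> i) f"

definition dc_norm :: "(nat \<Rightarrow> real) \<Rightarrow> (real^'n::finite) set \<Rightarrow> real \<Rightarrow> (real^'n \<Rightarrow> real) \<Rightarrow> ereal" where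
  "dc_norm M K h f =
     (SUP p\<in>{(\<alpha>, x). x \<in> K}. ereal (\<bar>pdm (fst p) f (snd p)\<bar> / (h ^ mlen (fst p) * M (mlen (fst p)))))"

definition E_Roumieu :: "(nat \<Rightarrow> real) \<Rightarrow> (real^'n::finite) set \<Rightarrow> (real^'n \<Rightarrow> real) set" where
  "E_Roumieu M U = {f. smooth_on U f \<and>
      (\<forall>K. compact K \<and> K \<subseteq> U \<longrightarrow> (\<exists>h>0. dc_norm M K h f < \<infinity>))}"

definition E_Beurling :: "(nat \<Rightarrow> real) \<Rightarrow> (real^'n::finite) set \<Rightarrow> (real^'n \<Rightarrow> real) set" where
  "E_Beurling M U = {f. smooth_on U f \<and>
      (\<forall>K. compact K \<and> K \<subseteq> U \<longrightarrow> (\<forall>h>0. dc_norm M K h f < \<infinity>))}"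

definition cube :: "nat \<Rightarrow> (real^'n::finite) set" where
  "cube k = {x. \<forall>i. \<bar>x $ i\<bar> < 1 / real k}"

definition jet :: "(real^'n::finite \<Rightarrow> real) \<Rightarrow> ('n \<Rightarrow> nat) \<Rightarrow> real" where
  "jet f = (\<lambda>\<alpha>. pdm \<alpha> f 0 / fact (mlen \<alpha>))"

text \<open>Images under the Borel map of the germ spaces at 0 (a germ is represented by
  any function of the class on some cube (-1/k,1/k)^r; the jet depends only on the germ).\<close>
definition jet_germs_Roumieu :: "(nat \<Rightarrow> real) \<Rightarrow> (('n::finite \<Rightarrow> nat) \<Rightarrow> real) set" where
  "jet_germs_Roumieu M = {jet f | f k. k > 0 \<and> f \<in> E_Roumieu M (cube k :: (real^'n) set)}"

definition jet_germs_Beurling :: "(nat \<Rightarrow> real) \<Rightarrow> (('n::finite \<Rightarrow> nat) \<Rightarrow> real) set" where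
  "jet_germs_Beurling M = {jet f | f k. k > 0 \<and> f \<in> E_Beurling M (cube k :: (real^'n) set)}"

definition seq_norm :: "(nat \<Rightarrow> real) \<Rightarrow> real \<Rightarrow> (('n::finite \<Rightarrow> nat) \<Rightarrow> real) \<Rightarrow> ereal" where
  "seq_norm N h b = (SUP \<alpha>. ereal (\<bar>b \<alpha>\<bar> / (h ^ mlen \<alpha> * (N (mlen \<alpha>) / fact (mlen \<alpha>)))))"

definition Lambda_R :: "(nat \<Rightarrow> real) \<Rightarrow> (('n::finite \<Rightarrow> nat) \<Rightarrow> real) set" where
  "Lambda_R N = {b. \<exists>h>0. seq_norm N h b < \<infinity>}"

text \<open>Absolutely convex 0-neighbourhoods of the locally convex inductive limit
  of the Banach spaces {b. seq_norm N h b < \<infinity>}: absolutely convex subsets U of Lambda_R N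
  such that U contains a ball of each step space.  They form a base of 0-neighbourhoods.\<close>
definition LB_zero_nbhd :: "(nat \<Rightarrow> real) \<Rightarrow> (('n::finite \<Rightarrow> nat) \<Rightarrow> real) set \<Rightarrow> bool" where
  "LB_zero_nbhd N U \<longleftrightarrow>
     U \<subseteq> Lambda_R N \<and>
     (\<forall>u\<in>U. \<forall>v\<in>U. \<forall>a c::real. \<bar>a\<bar> + \<bar>c\<bar> \<le> 1 \<longrightarrow> (\<lambda>\<alpha>. a * u \<alpha> + c * v \<alpha>) \<in> U) \<and>
     (\<forall>h>0. \<exists>\<epsilon>>0. \<forall>b. seq_norm N h b < ereal \<epsilon> \<longrightarrow> b \<in> U)"

definition dense_in_Lambda_R :: "(nat \<Rightarrow> real) \<Rightarrow> (('n::finite \<Rightarrow> nat) \<Rightarrow> real) set \<Rightarrow> bool" where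
  "dense_in_Lambda_R N D \<longleftrightarrow> D \<subseteq> Lambda_R N \<and>
     (\<forall>b\<in>Lambda_R N. \<forall>U. LB_zero_nbhd N U \<longrightarrow> (\<exists>d\<in>D. (\<lambda>\<alpha>. d \<alpha> - b \<alpha>) \<in> U))"

end

theory Submission
  imports Defs
begin

text \<open>
  Let \<open>d \<alpha> = N |\<alpha>| / |\<alpha>|!\<close>. If both \<open>b\<close> and \<open>b + c d\<close> with \<open>c > 0\<close> were jets of germs of class
  \<open>{M}\<close>, then the difference of these germs, restricted to a coordinate axis, would be a function of
  one variable all of whose derivatives at 0 are positive. By Bang's variant of the Denjoy-Carleman
  theorem, quasianalyticity forces all its derivatives to be nonnegative on some interval \<open>[0, a]\<close>, and
  then Taylor's formula with nonnegative remainder bounds \<open>N k / k! * a ^ k\<close> uniformly in \<open>k\<close>. This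
  contradicts the unboundedness of the \<open>k\<close>-th roots of \<open>N k / k!\<close>. So for each \<open>b\<close> either \<open>b\<close> itself or
  every \<open>b + c d\<close> lies outside the image of the Borel map, and \<open>c d\<close> is small for small \<open>c\<close>.
\<close>

section \<open>Log-convex sequences and partial sums of the exponential series\<close>

lemma log_convex_ratio_mono:
  fixes A :: "nat \<Rightarrow> real"
  assumes pos: "\<And>j. A j > 0"
    and lc: "\<And>j. (A (Suc j))\<^sup>2 \<le> A j * A (Suc (Suc j))"
  shows "mono (\<lambda>p. A (Suc p) / A p)"
proof (rule incseq_SucI)
  fix p
  show "A (Suc p) / A p \<le> A (Suc (Suc p)) / A (Suc p)"
    using lc[of p] pos[of p] pos[of "Suc p"] by (simp add: field_simps power2_eq_square)
qed

text \<open>The quotient of \<open>A (j + i)\<close> by \<open>A j\<close> is a product of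
  \<open>i\<close> consecutive ratios. Their indices are at most \<open>p\<close>, so by
  monotonicity each factor is at most the ratio at \<open>p\<close>.\<close>

lemma log_convex_le_ratio_power:
  fixes A :: "nat \<Rightarrow> real"
  assumes pos: "\<And>j. A j > 0"
    and lc: "\<And>j. (A (Suc j))\<^sup>2 \<le> A j * A (Suc (Suc j))"
    and "j + i \<le> Suc p"
  shows "A (j + i) \<le> A j * (A (Suc p) / A p) ^ i"
  using assms(3)
proof (induction i)
  case 0
  then show ?case by simp
next
  case (Suc i)
  have "A (j + Suc i) = A (j + i) * (A (Suc (j + i)) / A (j + i))"
    using pos[of "j + i"] by simp
  also have "\<dots> \<le> (A j * (A (Suc p) / A p) ^ i) * (A (Suc p) / A p)"
  proof (rule mult_mono)
    show "A (Suc (j + i)) / A (j + i) \<le> A (Suc p) / A p"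
      using monoD[OF log_convex_ratio_mono[of A, OF pos lc], of "j + i" p] Suc.prems by simp
  qed (use Suc pos in \<open>auto intro!: mult_nonneg_nonneg zero_le_power divide_nonneg_nonneg simp: less_imp_le\<close>)
  finally show ?case by (simp add: mult_ac)
qed

lemma exp_partial_sum_le:
  fixes z :: real
  assumes "0 \<le> z"
  shows "(\<Sum>i<m. z ^ i / fact i) \<le> exp z"
proof -
  have "(\<lambda>i. z ^ i / fact i) sums exp z"
    using exp_converges[of z] by (simp add: divide_inverse mult.commute)
  then show ?thesis
    using sum_le_suminf[of "\<lambda>i. z ^ i / fact i" "{..<m}"] assms
    by (auto simp: sums_iff)
qed

section \<open>Bang's weighted supremum and functions with controlled logarithmic variation\<close>

text \<open>When every \<open>F j\<close> is bounded by \<open>A j\<close>, the weight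
  \<open>exp (real j)\<close> makes the term of order \<open>j\<close> at most
  \<open>exp (- real j)\<close>. Hence orders above \<open>p\<close> cannot be seen above the level
  \<open>exp (- real (Suc p))\<close>.\<close>

definition bang :: "(nat \<Rightarrow> real) \<Rightarrow> (nat \<Rightarrow> real \<Rightarrow> real) \<Rightarrow> nat \<Rightarrow> real \<Rightarrow> real" where
  "bang A F n x = (SUP j\<in>{n..}. \<bar>F j x\<bar> / (exp (real j) * A j))"

text \<open>The smaller \<open>g\<close> is, the faster \<open>ln g\<close> may vary: \<open>\<mu> p\<close> only controls it where
  \<open>g\<close> exceeds \<open>exp (- (p + 1))\<close>.\<close>
definition truncated_ln_lipschitz :: "(nat \<Rightarrow> real) \<Rightarrow> real set \<Rightarrow> (real \<Rightarrow> real) \<Rightarrow> bool" where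
  "truncated_ln_lipschitz \<mu> S g \<longleftrightarrow>
     (\<forall>p. (\<mu> p)-lipschitz_on S (\<lambda>s. ln (max (g s) (exp (- real (Suc p))))))"

text \<open>This pastes the functions for successive orders into one along the chain of zeros in
  Bang's argument. Since truncation and logarithm act pointwise, the claim reduces to gluing
  Lipschitz functions.\<close>

lemma truncated_ln_lipschitz_concat:
  assumes "truncated_ln_lipschitz \<mu> {a..b} f" "truncated_ln_lipschitz \<mu> {b..c} g" "f b = g b"
  shows "truncated_ln_lipschitz \<mu> {a..c} (\<lambda>s. if s \<le> b then f s else g s)"
proof -
  have "(\<mu> p)-lipschitz_on {a..c} (\<lambda>s. if s \<le> b then ln (max (f s) (exp (- real (Suc p))))
          else ln (max (g s) (exp (- real (Suc p)))))" for p
    using assms by (intro lipschitz_on_concat) (auto simp: truncated_ln_lipschitz_def)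
  then show ?thesis
    unfolding truncated_ln_lipschitz_def by (simp add: if_distrib[of "\<lambda>u. ln (max u _)"] cong: if_cong)
qed

text \<open>To rise from \<open>exp (- real (Suc p))\<close> to \<open>exp (- real p)\<close>, the
  truncated logarithm gains 1, which at speed \<open>\<mu> p\<close> takes length at least
  \<open>1 / \<mu> p\<close>. The climbs through successive levels occupy consecutive intervals, so
  these lengths add up.\<close>

lemma truncated_ln_lipschitz_crossing:
  assumes lip: "truncated_ln_lipschitz \<mu> {c..d} g"
    and \<mu>: "\<And>p. \<mu> p > 0"
    and cd: "c \<le> d" and gc: "g c \<le> exp (- real (n + k))" and gd: "exp (- real n) \<le> g d"
  shows "(\<Sum>p\<in>{n..<n + k}. 1 / \<mu> p) \<le> d - c"
proof -
  \<comment> \<open>Here \<open>i\<close> counts the levels already climbed from the bottom, and the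
    inequality \<open>g s \<le> ...\<close> guarantees that the next climb starts no higher than its
    lower level.\<close>
  have "\<exists>s. c \<le> s \<and> s \<le> d \<and> g s \<le> exp (- real (n + k - i)) \<and>
          (\<Sum>p\<in>{n + k - i..<n + k}. 1 / \<mu> p) \<le> s - c" if "i \<le> k" for i
    using that
  proof (induction i)
    case 0
    then show ?case using cd gc by auto
  next
    case (Suc i)
    then obtain s where s: "c \<le> s" "s \<le> d" "g s \<le> exp (- real (n + k - i))"
        "(\<Sum>p\<in>{n + k - i..<n + k}. 1 / \<mu> p) \<le> s - c"
      by auto
    define p where "p = n + k - Suc i"
    have p: "n + k - i = Suc p" "n \<le> p" "p < n + k"
      using Suc.prems by (auto simp: p_def)
    define l where "l = (\<lambda>s. ln (max (g s) (exp (- real (Suc p)))))"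
    have L: "(\<mu> p)-lipschitz_on {c..d} l"
      using lip by (auto simp: truncated_ln_lipschitz_def l_def)
    \<comment> \<open>At \<open>s\<close> the truncation is active, which gives the exact starting
      value.\<close>
    have ls: "l s = - real (Suc p)"
      using s(3) by (simp add: l_def p max_def)
    have "exp (- real p) \<le> g d"
      using gd p(2) by (smt (verit) exp_le_cancel_iff of_nat_mono)
    then have "exp (- real p) \<le> max (g d) (exp (- real (Suc p)))"
      by simp
    then have ld: "- real p \<le> l d"
      unfolding l_def by (subst ln_ge_iff) (auto simp: less_max_iff_disj)
    have "continuous_on {s..d} l"
      using lipschitz_on_continuous_on[OF L] s(1) by (auto intro: continuous_on_subset)
    then obtain s' where s': "s \<le> s'" "s' \<le> d" "l s' = - real p"
      using IVT'[of l s "- real p" d] ls ld s by auto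
    have "max (g s') (exp (- real (Suc p))) = exp (- real p)"
      using s'(3) unfolding l_def by (metis exp_gt_zero exp_ln less_max_iff_disj)
    then have gs': "g s' \<le> exp (- real p)"
      by (metis max.cobounded1)
    have "dist (l s') (l s) \<le> \<mu> p * dist s' s"
      using s s' by (intro lipschitz_onD[OF L]) auto
    then have "1 / \<mu> p \<le> s' - s"
      using \<mu>[of p] s' ls by (simp add: dist_real_def field_simps)
    moreover have "(\<Sum>q\<in>{p..<n + k}. 1 / \<mu> q) = 1 / \<mu> p + (\<Sum>q\<in>{Suc p..<n + k}. 1 / \<mu> q)"
      using p by (simp add: sum.atLeast_Suc_lessThan)
    ultimately show ?case
      using s s' gs' p(1) by (intro exI[of _ s']) (auto simp: p_def[symmetric])
  qed
  from this[of k] show ?thesis by auto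
qed

section \<open>Bang's theorem on functions with positive derivatives at 0\<close>

locale bang_setup =
  fixes A :: "nat \<Rightarrow> real" and F :: "nat \<Rightarrow> real \<Rightarrow> real" and a :: real
  assumes pos: "\<And>j. A j > 0"
    and log_convex: "\<And>j. (A (Suc j))\<^sup>2 \<le> A j * A (Suc (Suc j))"
    and deriv: "\<And>j x. x \<in> {0..a} \<Longrightarrow> (F j has_real_derivative F (Suc j) x) (at x)"
    and bound: "\<And>j x. x \<in> {0..a} \<Longrightarrow> \<bar>F j x\<bar> \<le> A j"
begin

abbreviation "B \<equiv> bang A F"

text \<open>One more derivative costs a ratio of \<open>A\<close>, at most the one at
  \<open>p\<close> for orders up to \<open>p\<close>, and the factor \<open>exp 1\<close> from the
  weight in \<open>bang\<close>.\<close>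

definition rate :: "nat \<Rightarrow> real" where
  "rate p = exp 1 * (A (Suc p) / A p)"

lemma rate_pos: "rate p > 0"
  using pos by (simp add: rate_def)

lemma quotient_le_exp:
  assumes "x \<in> {0..a}"
  shows "\<bar>F j x\<bar> / (exp (real j) * A j) \<le> exp (- real j)"
  using bound[OF assms, of j] pos[of j] by (simp add: exp_minus field_simps)

lemma B_bdd: "x \<in> {0..a} \<Longrightarrow> bdd_above ((\<lambda>j. \<bar>F j x\<bar> / (exp (real j) * A j)) ` {n..})"
  by (rule bdd_aboveI2[of _ _ 1], rule order_trans[OF quotient_le_exp]) auto

lemma quotient_le_B:
  assumes "x \<in> {0..a}" "n \<le> j"
  shows "\<bar>F j x\<bar> / (exp (real j) * A j) \<le> B n x"
  unfolding bang_def using assms B_bdd by (intro cSUP_upper) auto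

lemma abs_le_B:
  assumes "x \<in> {0..a}" "n \<le> j"
  shows "\<bar>F j x\<bar> \<le> B n x * (exp (real j) * A j)"
  using quotient_le_B[OF assms] pos[of j] by (simp add: divide_le_eq)

lemma B_leI:
  assumes "\<And>j. n \<le> j \<Longrightarrow> \<bar>F j x\<bar> / (exp (real j) * A j) \<le> c"
  shows "B n x \<le> c"
  unfolding bang_def using assms by (intro cSUP_least) auto

lemma B_le_exp: "x \<in> {0..a} \<Longrightarrow> B n x \<le> exp (- real n)"
  by (rule B_leI, rule order_trans[OF quotient_le_exp]) auto

lemma B_nonneg: "x \<in> {0..a} \<Longrightarrow> 0 \<le> B n x"
  by (rule order_trans[OF _ quotient_le_B[of x n n]]) (use pos[of n] in auto)

text \<open>The two suprema differ only by the term of order \<open>n\<close>, which vanishes at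
  \<open>x\<close>.\<close>

lemma B_Suc_at_zero:
  assumes x: "x \<in> {0..a}" and "F n x = 0"
  shows "B (Suc n) x = B n x"
proof (rule antisym)
  show "B (Suc n) x \<le> B n x"
    by (rule B_leI) (use x quotient_le_B in auto)
  show "B n x \<le> B (Suc n) x"
  proof (rule B_leI)
    fix j assume "n \<le> j"
    then show "\<bar>F j x\<bar> / (exp (real j) * A j) \<le> B (Suc n) x"
      using assms quotient_le_B[of x "Suc n" j] B_nonneg[of x "Suc n"] by (cases "j = n") auto
  qed
qed

text \<open>Expand \<open>F j\<close> at \<open>x\<close> up to order \<open>Suc p\<close>; the Lagrange remainder is absorbed by the
  truncation.\<close>
lemma B_growth:
  assumes x: "x \<in> {0..a}" and y: "y \<in> {0..a}"
  shows "B n y \<le> max (B n x) (exp (- real (Suc p))) * exp (rate p * \<bar>y - x\<bar>)"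
proof (rule B_leI)
  fix j assume j: "n \<le> j"
  define G where "G = max (B n x) (exp (- real (Suc p)))"
  define \<delta> where "\<delta> = \<bar>y - x\<bar>"
  define r where "r = A (Suc p) / A p"
  have G: "B n x \<le> G" "exp (- real (Suc p)) \<le> G" "0 < G"
    by (auto simp: G_def less_max_iff_disj)
  have r: "0 < r" using pos by (simp add: r_def)
  have z: "0 \<le> rate p * \<delta>" using rate_pos[of p] by (simp add: \<delta>_def)
  have tail: "G \<le> G * exp (rate p * \<delta>)"
    using G(3) z by simp
  have "\<bar>F j y\<bar> / (exp (real j) * A j) \<le> G * exp (rate p * \<delta>)"
  proof (cases "Suc p \<le> j")
    case True
    have "\<bar>F j y\<bar> / (exp (real j) * A j) \<le> exp (- real j)"
      by (rule quotient_le_exp[OF y])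
    also have "\<dots> \<le> exp (- real (Suc p))" using True by simp
    finally show ?thesis using G tail by linarith
  next
    case False
    then have jp: "j \<le> p" by simp
    show ?thesis
    proof (cases "x = y")
      case True
      then have "\<bar>F j y\<bar> / (exp (real j) * A j) \<le> G"
        using quotient_le_B[OF y j] G(1) by simp
      then show ?thesis using tail by linarith
    next
      case False
      \<comment> \<open>The expansion length is chosen so that the remainder is a derivative of
        order exactly \<open>Suc p\<close>.\<close>
      define m where "m = Suc p - j"
      have m: "m > 0" "j + m = Suc p" using jp by (auto simp: m_def)
      obtain t where t: "if y < x then y < t \<and> t < x else x < t \<and> t < y"
        and eq: "F j y = (\<Sum>i<m. F (j + i) x / fact i * (y - x) ^ i) + F (j + m) t / fact m * (y - x) ^ m"
        using Taylor[of m "\<lambda>i. F (j + i)" "F j" 0 a x y] m(1) x y False deriv by auto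
      have ta: "t \<in> {0..a}" using t x y by (auto split: if_splits)
      \<comment> \<open>One estimate serves both the Taylor terms, where \<open>c\<close> is a
        derivative at \<open>x\<close> controlled by \<open>B n x\<close>, and the remainder, where
        \<open>c\<close> is \<open>F (Suc p)\<close> at the intermediate point \<open>t\<close> and
        only the a priori bound is available.\<close>
      have term_le: "\<bar>c / fact i * (y - x) ^ i\<bar> \<le> G * exp (real j) * A j * ((rate p * \<delta>) ^ i / fact i)"
        if c: "\<bar>c\<bar> \<le> G * (exp (real (j + i)) * A (j + i))" and i: "j + i \<le> Suc p" for c i
      proof -
        have "\<bar>c\<bar> \<le> G * (exp (real (j + i)) * (A j * r ^ i))"
          using c log_convex_le_ratio_power[of A, OF pos log_convex i] G(3) unfolding r_def
          by (smt (verit) exp_gt_zero mult_left_mono)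
        also have "exp (real (j + i)) = exp (real j) * exp 1 ^ i"
          by (simp add: exp_add exp_of_nat_mult[of i 1, simplified])
        finally have c': "\<bar>c\<bar> \<le> G * exp (real j) * A j * (exp 1 * r) ^ i"
          by (simp add: power_mult_distrib mult_ac)
        have "\<bar>c / fact i * (y - x) ^ i\<bar> = \<bar>c\<bar> * (\<delta> ^ i / fact i)"
          by (simp add: abs_mult power_abs \<delta>_def)
        also have "\<dots> \<le> G * exp (real j) * A j * (exp 1 * r) ^ i * (\<delta> ^ i / fact i)"
          using c' by (intro mult_right_mono) (auto simp: \<delta>_def)
        also have "\<dots> = G * exp (real j) * A j * ((rate p * \<delta>) ^ i / fact i)"
          by (simp only: rate_def r_def[symmetric] power_mult_distrib times_divide_eq_right mult_ac)
        finally show ?thesis .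
      qed
      have "\<bar>F j y\<bar> \<le> (\<Sum>i<m. \<bar>F (j + i) x / fact i * (y - x) ^ i\<bar>) + \<bar>F (j + m) t / fact m * (y - x) ^ m\<bar>"
        unfolding eq by (rule order_trans[OF abs_triangle_ineq]) (intro add_right_mono sum_abs)
      also have "\<dots> \<le> (\<Sum>i<m. G * exp (real j) * A j * ((rate p * \<delta>) ^ i / fact i))
           + G * exp (real j) * A j * ((rate p * \<delta>) ^ m / fact m)"
      proof (intro add_mono sum_mono term_le)
        fix i assume "i \<in> {..<m}"
        then show "j + i \<le> Suc p" using m by auto
        have "\<bar>F (j + i) x\<bar> \<le> B n x * (exp (real (j + i)) * A (j + i))"
          by (rule abs_le_B) (use x j in auto)
        also have "\<dots> \<le> G * (exp (real (j + i)) * A (j + i))"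
          using G pos[of "j + i"] by (intro mult_right_mono) auto
        finally show "\<bar>F (j + i) x\<bar> \<le> G * (exp (real (j + i)) * A (j + i))" .
      next
        have "\<bar>F (j + m) t\<bar> \<le> exp (- real (Suc p)) * (exp (real (Suc p)) * A (Suc p))"
          using bound[OF ta, of "Suc p"] m(2) by (simp add: mult.assoc[symmetric] exp_add[symmetric])
        also have "\<dots> \<le> G * (exp (real (Suc p)) * A (Suc p))"
          using G pos[of "Suc p"] by (intro mult_right_mono) auto
        finally show "\<bar>F (j + m) t\<bar> \<le> G * (exp (real (j + m)) * A (j + m))"
          using m(2) by simp
        show "j + m \<le> Suc p" using m by simp
      qed
      also have "\<dots> = G * exp (real j) * A j * (\<Sum>i<Suc m. (rate p * \<delta>) ^ i / fact i)"
        by (simp add: sum_distrib_left distrib_left)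
      also have "\<dots> \<le> G * exp (real j) * A j * exp (rate p * \<delta>)"
        using G(3) pos[of j] by (intro mult_left_mono exp_partial_sum_le[OF z]) auto
      finally show ?thesis
        using pos[of j] by (simp add: divide_le_eq mult_ac)
    qed
  qed
  then show "\<bar>F j y\<bar> / (exp (real j) * A j) \<le> max (B n x) (exp (- real (Suc p))) * exp (rate p * \<bar>y - x\<bar>)"
    by (simp add: G_def \<delta>_def)
qed

text \<open>The logarithm of \<open>B_growth\<close> bounds the increase from one point to another;
  exchanging the two points bounds the decrease.\<close>

lemma B_truncated_ln_lipschitz:
  assumes "S \<subseteq> {0..a}"
  shows "truncated_ln_lipschitz rate S (B n)"
  unfolding truncated_ln_lipschitz_def
proof (intro allI lipschitz_onI)
  fix p x y
  assume xy: "x \<in> S" "y \<in> S"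
  let ?g = "\<lambda>s. max (B n s) (exp (- real (Suc p)))"
  have gpos: "?g s > 0" for s by (auto simp: less_max_iff_disj)
  have *: "ln (?g v) - ln (?g u) \<le> rate p * \<bar>u - v\<bar>" if "u \<in> S" "v \<in> S" for u v
  proof -
    have "?g u * 1 \<le> ?g u * exp (rate p * \<bar>v - u\<bar>)"
      using gpos[of u] rate_pos[of p] by (intro mult_left_mono) auto
    then have "?g v \<le> ?g u * exp (rate p * \<bar>v - u\<bar>)"
      using B_growth[of u v n p] that assms by (auto simp: subset_iff)
    then have "ln (?g v) \<le> ln (?g u * exp (rate p * \<bar>v - u\<bar>))"
      using gpos[of v] by (intro ln_mono) auto
    also have "\<dots> = ln (?g u) + rate p * \<bar>v - u\<bar>"
      using gpos[of u] by (subst ln_mult) auto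
    finally show ?thesis by (simp add: abs_minus_commute)
  qed
  show "dist (ln (?g x)) (ln (?g y)) \<le> rate p * dist x y"
    using *[OF xy] *[OF xy(2,1)] by (auto simp: dist_real_def abs_le_iff abs_minus_commute)
qed (use rate_pos less_imp_le in blast)

text \<open>If some \<open>F k\<close> were negative somewhere, Rolle's theorem would give zeros
  \<open>x\<^sub>k > x\<^sub>k\<^sub>+\<^sub>1 > \<dots> > 0\<close> of \<open>F k, F (k + 1), \<dots>\<close>. Passing from index \<open>m\<close> to
  \<open>m + 1\<close> at \<open>x\<^sub>m\<close> does not change \<open>B\<close>, so \<open>B\<close> decays to 0 along a path of length at most \<open>a\<close>,
  although this needs length at least the sum of all \<open>1 / rate p\<close>.\<close>
theorem bang_nonneg:
  assumes qa: "\<not> summable (\<lambda>p. A p / A (Suc p))"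
    and F0: "\<And>j. F j 0 > 0"
    and y: "y \<in> {0..a}"
  shows "F k y \<ge> 0"
proof (rule ccontr)
  assume "\<not> F k y \<ge> 0"
  then have neg: "F k y < 0" by simp
  have y0: "y > 0" using neg F0[of k] y by (cases "y = 0") auto
  have zero: "\<exists>x>0. x < w \<and> F m x = 0" if w: "F m w < 0" "w > 0" "w \<le> y" for m w
  proof -
    have "continuous_on {0..w} (F m)"
      using w y by (intro continuous_at_imp_continuous_on ballI DERIV_isCont[OF deriv]) auto
    then obtain x where x: "0 \<le> x" "x \<le> w" "F m x = 0"
      using IVT2'[of "F m" w 0 0] w F0[of m] by auto
    then show ?thesis using w F0[of m] by (intro exI[of _ x]) (auto simp: order_less_le)
  qed
  \<comment> \<open>The function \<open>g\<close> is pasted from right to left out of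
    \<open>B k\<close>, ..., \<open>B (k + i)\<close>, switching to the next order at each
    zero.\<close>
  have path: "\<exists>x g. 0 < x \<and> x \<le> y \<and> F (k + i) x = 0 \<and> g x = B (k + i) x \<and> g y = B k y \<and>
      truncated_ln_lipschitz rate {x..y} g" for i
  proof (induction i)
    case 0
    obtain x where "0 < x" "x < y" "F k x = 0" using zero[OF neg y0] by auto
    then show ?case
      using y by (intro exI[of _ x] exI[of _ "B k"]) (auto intro: B_truncated_ln_lipschitz)
  next
    case (Suc i)
    then obtain x g where x: "0 < x" "x \<le> y" "F (k + i) x = 0" and g: "g x = B (k + i) x" "g y = B k y"
      "truncated_ln_lipschitz rate {x..y} g" by auto
    \<comment> \<open>\<open>F (k + i)\<close> falls from a positive value at 0 to zero at
      \<open>x\<close>, so its derivative is negative somewhere in between and, being positive at 0,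
      vanishes further left.\<close>
    obtain w where w: "0 < w" "w < x" "F (k + i) x - F (k + i) 0 = (x - 0) * F (Suc (k + i)) w"
      using MVT2[OF x(1), of "F (k + i)" "F (Suc (k + i))"] deriv x y by auto
    have "F (Suc (k + i)) w < 0"
      using w x F0[of "k + i"] by (smt (verit) mult_nonneg_nonneg)
    then obtain x' where x': "0 < x'" "x' < w" "F (Suc (k + i)) x' = 0"
      using zero[of "Suc (k + i)" w] w x by auto
    define h where "h = (\<lambda>s. if s \<le> x then B (Suc (k + i)) s else g s)"
    have "truncated_ln_lipschitz rate {x'..y} h"
      unfolding h_def
    proof (rule truncated_ln_lipschitz_concat[OF _ g(3)])
      show "truncated_ln_lipschitz rate {x'..x} (B (Suc (k + i)))"
        using x x' w y by (intro B_truncated_ln_lipschitz) auto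
      show "B (Suc (k + i)) x = g x"
        using B_Suc_at_zero[of x "k + i"] x y g by auto
    qed
    moreover have "h y = B k y"
      using B_Suc_at_zero[of x "k + i"] x y g by (auto simp: h_def)
    moreover have "h x' = B (Suc (k + i)) x'" using x' w by (simp add: h_def)
    ultimately show ?case
      using x x' w by (intro exI[of _ x'] exI[of _ h]) auto
  qed
  have "B k y > 0"
    using quotient_le_B[OF y, of k k] neg pos[of k]
    by (smt (verit) divide_pos_pos exp_gt_zero mult_pos_pos order_refl)
  obtain n0 :: nat where n0: "- ln (B k y) \<le> real n0" using real_arch_simple by blast
  \<comment> \<open>The summand \<open>n0\<close> brings \<open>exp (- real n)\<close> below
    \<open>B k y\<close>; the summand \<open>k\<close> makes the order \<open>k + (n0 + i)\<close>
    reached by the path equal to \<open>n + i\<close>.\<close>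
  define n where "n = n0 + k"
  have n: "exp (- real n) \<le> B k y"
  proof -
    have "exp (- real n) \<le> exp (ln (B k y))" using n0 by (simp add: n_def)
    then show ?thesis using \<open>B k y > 0\<close> by simp
  qed
  have part: "(\<Sum>p\<in>{n..<n + i}. 1 / rate p) \<le> a" for i
  proof -
    obtain x g where x: "0 < x" "x \<le> y" and g: "g x = B (k + (n0 + i)) x" "g y = B k y"
      "truncated_ln_lipschitz rate {x..y} g" using path[of "n0 + i"] by auto
    have "(\<Sum>p\<in>{n..<n + i}. 1 / rate p) \<le> y - x"
    proof (rule truncated_ln_lipschitz_crossing[OF g(3) rate_pos x(2)])
      show "g x \<le> exp (- real (n + i))"
        using B_le_exp[of x "k + (n0 + i)"] x y g by (simp add: n_def add_ac)
      show "exp (- real n) \<le> g y" using n g by simp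
    qed
    then show ?thesis using x y by auto
  qed
  have "summable (\<lambda>i. 1 / rate (i + n))"
  proof (rule bounded_imp_summable)
    show "0 \<le> 1 / rate (i + n)" for i using rate_pos[of "i + n"] by simp
    show "(\<Sum>i\<le>m. 1 / rate (i + n)) \<le> a" for m
      using part[of "Suc m"] sum.shift_bounds_nat_ivl[of "\<lambda>p. 1 / rate p" 0 n "Suc m"]
      by (simp add: atLeast0LessThan lessThan_Suc_atMost add_ac del: sum.lessThan_Suc)
  qed
  then have "summable (\<lambda>p. 1 / rate p)" by (subst (asm) summable_iff_shift)
  then have "summable (\<lambda>p. exp 1 * (1 / rate p))" by (rule summable_mult)
  then show False using qa by (simp add: rate_def)
qed

text \<open>In Taylor's formula at the point \<open>a\<close> the remainder is nonnegative by
  \<open>bang_nonneg\<close> and all other terms are positive. So each single term is at most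
  \<open>F 0 a\<close>, hence at most \<open>A 0\<close>, whatever its order.\<close>

corollary taylor_coefficients_bounded:
  assumes qa: "\<not> summable (\<lambda>p. A p / A (Suc p))"
    and F0: "\<And>j. F j 0 > 0"
    and a: "a > 0"
  shows "F j 0 / fact j * a ^ j \<le> A 0"
proof -
  obtain t where t: "0 < t" "t < a"
    and eq: "F 0 a = (\<Sum>i<Suc j. F i 0 / fact i * (a - 0) ^ i) + F (Suc j) t / fact (Suc j) * (a - 0) ^ Suc j"
    using Taylor[of "Suc j" F "F 0" 0 a 0 a] a deriv by auto
  have "F j 0 / fact j * a ^ j \<le> (\<Sum>i<Suc j. F i 0 / fact i * a ^ i)"
    using F0 a by (intro member_le_sum) (auto simp: less_imp_le)
  also have "\<dots> \<le> F 0 a"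
    using eq bang_nonneg[OF qa F0, of t "Suc j"] t a by simp
  also have "\<dots> \<le> A 0"
    using bound[of a 0] a by auto
  finally show ?thesis .
qed

end

section \<open>Restriction of germs to a coordinate axis\<close>

lemma count_list_only_imp_replicate:
  assumes "\<forall>j. count_list xs j = (if j = i then k else 0)"
  shows "xs = replicate k i"
proof -
  have "\<forall>j\<in>set xs. j = i"
    using assms by (metis count_list_0_iff)
  then have "xs = replicate (length xs) i"
    by (simp add: replicate_length_same)
  moreover have "count_list (replicate n i) i = n" for n
    by (induction n) auto
  ultimately show ?thesis
    using assms by metis
qed

text \<open>For a multi-index supported on one coordinate only one list has the required counts, so
  the choice in \<open>pdm\<close> is determined.\<close>

lemma pdm_axis: "pdm (\<lambda>j. if j = i then k else 0) f = pds (replicate k i) f"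
proof -
  have "count_list (replicate k i) j = (if j = i then k else 0)" for j
    by (induction k) auto
  then have "(SOME xs. \<forall>j. count_list xs j = (if j = i then k else 0)) = replicate k i"
    by (intro some_equality) (auto intro: count_list_only_imp_replicate)
  then show ?thesis by (simp add: pdm_def)
qed

lemma mlen_axis: "mlen (\<lambda>j. if j = i then k else 0) = k"
  by (simp add: mlen_def)

lemma ereal_le_real_of_less_infinity:
  assumes "(x :: ereal) < \<infinity>"
  shows "\<exists>C. x \<le> ereal C"
  using assms by (cases x) auto

definition axis_deriv :: "(real^'n::finite \<Rightarrow> real) \<Rightarrow> 'n \<Rightarrow> nat \<Rightarrow> real \<Rightarrow> real" where
  "axis_deriv f i j t = pds (replicate j i) f (t *\<^sub>R axis i 1)"

lemma jet_axis: "jet f (\<lambda>j. if j = i then m else 0) = axis_deriv f i m 0 / fact m"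
  by (simp add: jet_def pdm_axis mlen_axis axis_deriv_def)

text \<open>The segment from 0 to \<open>a\<close> on the axis is a compact subset of the cube, so a
  single pair of constants serves all derivatives along it.\<close>

lemma E_Roumieu_axis:
  fixes f :: "real^'n::finite \<Rightarrow> real" and i :: 'n
  assumes f: "f \<in> E_Roumieu M (cube k)" and k: "k > 0" and a: "0 \<le> a" "a < 1 / real k"
    and M: "\<And>p. M p > 0"
  shows "x \<in> {0..a} \<Longrightarrow> (axis_deriv f i j has_real_derivative axis_deriv f i (Suc j) x) (at x)"
    and "\<exists>C>0. \<exists>h>0. \<forall>j. \<forall>x\<in>{0..a}. \<bar>axis_deriv f i j x\<bar> \<le> C * h ^ j * M j"
proof -
  have in_cube: "x *\<^sub>R axis i 1 \<in> (cube k :: (real^'n) set)" if "x \<in> {0..a}" for x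
    using that a k by (auto simp: cube_def axis_def)
  show "(axis_deriv f i j has_real_derivative axis_deriv f i (Suc j) x) (at x)" if x: "x \<in> {0..a}"
  proof -
    have "((\<lambda>t. pds (replicate j i) f (x *\<^sub>R axis i 1 + t *\<^sub>R axis i 1)) has_real_derivative
             pds (i # replicate j i) f (x *\<^sub>R axis i 1)) (at 0)"
      using f in_cube[OF x] unfolding E_Roumieu_def smooth_on_def by blast
    then have "((\<lambda>t. axis_deriv f i j (t + x)) has_real_derivative axis_deriv f i (Suc j) x) (at 0)"
      by (simp add: axis_deriv_def scaleR_add_left add_ac)
    then show ?thesis using DERIV_shift[of "axis_deriv f i j" "axis_deriv f i (Suc j) x" 0 x] by simp
  qed
  define K where "K = (\<lambda>x. x *\<^sub>R (axis i 1 :: real^'n)) ` {0..a}"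
  have "compact K" unfolding K_def
    by (intro compact_continuous_image continuous_intros) auto
  moreover have "K \<subseteq> cube k" using in_cube by (auto simp: K_def)
  ultimately obtain h where h: "h > 0" "dc_norm M K h f < \<infinity>"
    using f unfolding E_Roumieu_def by blast
  then obtain C where C: "dc_norm M K h f \<le> ereal C"
    using ereal_le_real_of_less_infinity by blast
  have "\<bar>axis_deriv f i j x\<bar> \<le> max C 1 * h ^ j * M j" if x: "x \<in> {0..a}" for j x
  proof -
    have "ereal (\<bar>axis_deriv f i j x\<bar> / (h ^ j * M j)) \<le> dc_norm M K h f"
      unfolding dc_norm_def
      by (rule SUP_upper2[of "(\<lambda>l. if l = i then j else 0, x *\<^sub>R axis i 1)"])
         (use x in \<open>auto simp: K_def axis_deriv_def pdm_axis mlen_axis\<close>)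
    then have "\<bar>axis_deriv f i j x\<bar> / (h ^ j * M j) \<le> max C 1"
      using C by (meson ereal_less_eq(3) max.coboundedI1 order_trans)
    then show ?thesis
      using h(1) M[of j] by (simp add: divide_le_eq mult_ac)
  qed
  then show "\<exists>C>0. \<exists>h>0. \<forall>j. \<forall>x\<in>{0..a}. \<bar>axis_deriv f i j x\<bar> \<le> C * h ^ j * M j"
    using h(1) by (intro exI[of _ "max C 1"] conjI exI[of _ h]) auto
qed

text \<open>The restrictions of \<open>f\<close> and \<open>g\<close> to the axis have a difference
  whose derivatives at 0 are the positive numbers \<open>d m * fact m\<close>. Bang's theorem
  applies to it and bounds its Taylor coefficients.\<close>

lemma jet_difference_bounded:
  fixes f g :: "real^'n::finite \<Rightarrow> real" and i :: 'n
  assumes M: "weight_seq M" "quasianalytic M"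
    and f: "f \<in> E_Roumieu M (cube k)" "k > 0" and g: "g \<in> E_Roumieu M (cube l)" "l > 0"
    and diff: "\<And>m. jet g (\<lambda>j. if j = i then m else 0) - jet f (\<lambda>j. if j = i then m else 0) = d m"
    and d: "\<And>m. d m > 0"
  shows "\<exists>a>0. \<exists>C. \<forall>m. d m * a ^ m \<le> C"
proof -
  have Mpos: "M p > 0" for p using M by (simp add: weight_seq_def)
  have Mlc: "(M (Suc p))\<^sup>2 \<le> M p * M (Suc (Suc p))" for p
    using M unfolding weight_seq_def by (metis Suc_eq_plus1 diff_Suc_1 le_add2)
  \<comment> \<open>Halving keeps the closed segment inside both open cubes.\<close>
  define a where "a = min (1 / real k) (1 / real l) / 2"
  have a: "0 < a" "a < 1 / real k" "a < 1 / real l"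
    using f(2) g(2) by (auto simp: a_def min_def field_simps)
  define F where "F = axis_deriv f i"
  define G where "G = axis_deriv g i"
  note F = E_Roumieu_axis[OF f less_imp_le[OF a(1)] a(2) Mpos, where i=i, folded F_def]
  note G = E_Roumieu_axis[OF g less_imp_le[OF a(1)] a(3) Mpos, where i=i, folded G_def]
  obtain C h where C: "C > 0" "h > 0" "\<And>j x. x \<in> {0..a} \<Longrightarrow> \<bar>F j x\<bar> \<le> C * h ^ j * M j"
    using F(2) by blast
  obtain C' h' where C': "C' > 0" "h' > 0" "\<And>j x. x \<in> {0..a} \<Longrightarrow> \<bar>G j x\<bar> \<le> C' * h' ^ j * M j"
    using G(2) by blast
  define H where "H = max h h'"
  have H: "h \<le> H" "h' \<le> H" "H > 0" using C C' by (auto simp: H_def)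
  \<comment> \<open>This common majorant differs from \<open>M\<close> by a constant and a geometric
    factor: log-convexity persists, and the ratios \<open>A p / A (Suc p)\<close> are those of
    \<open>M\<close> divided by \<open>H\<close>.\<close>
  define A where "A = (\<lambda>j. (C + C') * H ^ j * M j)"
  interpret bang_setup A "\<lambda>j t. G j t - F j t" a
  proof
    show "A j > 0" for j using C C' H Mpos by (simp add: A_def)
    show "(A (Suc j))\<^sup>2 \<le> A j * A (Suc (Suc j))" for j
    proof -
      have "(A (Suc j))\<^sup>2 = ((C + C') * H ^ Suc j)\<^sup>2 * (M (Suc j))\<^sup>2"
        by (simp add: A_def power_mult_distrib)
      also have "\<dots> \<le> ((C + C') * H ^ Suc j)\<^sup>2 * (M j * M (Suc (Suc j)))"
        by (intro mult_left_mono Mlc) auto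
      finally show ?thesis by (simp add: A_def power2_eq_square mult_ac)
    qed
    show "((\<lambda>t. G j t - F j t) has_real_derivative G (Suc j) x - F (Suc j) x) (at x)" if "x \<in> {0..a}" for j x
      using F(1) G(1) that by (intro DERIV_diff) auto
    show "\<bar>G j x - F j x\<bar> \<le> A j" if x: "x \<in> {0..a}" for j x
    proof -
      have "C * h ^ j * M j \<le> C * H ^ j * M j" "C' * h' ^ j * M j \<le> C' * H ^ j * M j"
        using C C' H Mpos[of j] by (auto intro!: mult_right_mono mult_left_mono power_mono)
      then show ?thesis
        using C(3)[OF x, of j] C'(3)[OF x, of j] by (simp add: A_def algebra_simps)
    qed
  qed
  have "\<not> summable (\<lambda>p. A p / A (Suc p))"
  proof
    assume "summable (\<lambda>p. A p / A (Suc p))"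
    then have "summable (\<lambda>p. H * (A p / A (Suc p)))" by (rule summable_mult)
    moreover have "H * (A p / A (Suc p)) = M p / M (Suc p)" for p
    proof -
      have "C + C' \<noteq> 0" using C(1) C'(1) by simp
      then show ?thesis
        using H(3) Mpos[of "Suc p"] by (simp add: A_def)
    qed
    ultimately show False using M(2) by (simp add: quasianalytic_def)
  qed
  moreover have eq: "d m = (G m 0 - F m 0) / fact m" for m
    using diff[of m] by (simp add: jet_axis F_def G_def diff_divide_distrib)
  moreover have "G m 0 - F m 0 > 0" for m
    using d[of m] eq[of m] by (simp add: zero_less_divide_iff)
  ultimately have "d m * a ^ m \<le> A 0" for m
    using taylor_coefficients_bounded[of m] a(1) by simp
  then show ?thesis using a(1) by blast
qed

section \<open>Growth of roots, the sequence space and density\<close>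

lemma SUP_root_finite_of_geometric_bound:
  fixes c :: "nat \<Rightarrow> real"
  assumes a: "a > 0" and C: "\<And>m. c m * a ^ m \<le> C" and c: "\<And>m. c m > 0"
  shows "(SUP k\<in>{0<..}. ereal (root k (c k))) < \<infinity>"
proof -
  have "(SUP k\<in>{0<..}. ereal (root k (c k))) \<le> ereal (max C 1 / a)"
  proof (intro SUP_least)
    fix k :: nat assume "k \<in> {0<..}"
    then have k: "k > 0" by simp
    \<comment> \<open>Replacing \<open>C\<close> by \<open>max C 1\<close> makes the constant at
      most its own \<open>k\<close>-th power, so that taking roots gives a bound independent of
      \<open>k\<close>.\<close>
    have "c k * a ^ k \<le> max C 1 ^ k"
      using C[of k] self_le_power[of "max C 1" k] k by simp
    then have "c k \<le> (max C 1 / a) ^ k"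
      using a by (simp add: power_divide field_simps)
    then have "root k (c k) \<le> root k ((max C 1 / a) ^ k)"
      using k by simp
    then show "ereal (root k (c k)) \<le> ereal (max C 1 / a)"
      using k a by (simp add: real_root_power_cancel)
  qed
  then show ?thesis by (rule order_le_less_trans) simp
qed

lemma E_Beurling_subset_Roumieu: "E_Beurling M U \<subseteq> E_Roumieu M U"
  unfolding E_Beurling_def E_Roumieu_def by (auto intro: zero_less_one)

lemma jet_germs_Beurling_subset_Roumieu: "jet_germs_Beurling M \<subseteq> jet_germs_Roumieu M"
  unfolding jet_germs_Beurling_def jet_germs_Roumieu_def using E_Beurling_subset_Roumieu by blast

lemma seq_norm_leI:
  assumes "\<And>\<alpha>. \<bar>b \<alpha>\<bar> / (h ^ mlen \<alpha> * (N (mlen \<alpha>) / fact (mlen \<alpha>))) \<le> c"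
  shows "seq_norm N h b \<le> ereal c"
  unfolding seq_norm_def using assms by (intro SUP_least) auto

lemma Lambda_R_add_multiple:
  fixes b :: "('n::finite \<Rightarrow> nat) \<Rightarrow> real"
  assumes N: "\<And>p. N p > 0" and b: "b \<in> Lambda_R N" and c: "c \<ge> 0"
  shows "(\<lambda>\<alpha>. b \<alpha> + c * (N (mlen \<alpha>) / fact (mlen \<alpha>))) \<in> Lambda_R N"
proof -
  obtain h where h: "h > 0" "seq_norm N h b < \<infinity>"
    using b by (auto simp: Lambda_R_def)
  then obtain C where C: "seq_norm N h b \<le> ereal C"
    using ereal_le_real_of_less_infinity by blast
  \<comment> \<open>\<open>H \<ge> h\<close> preserves the bound for \<open>b\<close>, and
    \<open>H \<ge> 1\<close> bounds the contribution of the added multiple by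
    \<open>c\<close>.\<close>
  define H where "H = max h 1"
  have "seq_norm N H (\<lambda>\<alpha>. b \<alpha> + c * (N (mlen \<alpha>) / fact (mlen \<alpha>))) \<le> ereal (max C 0 + c)"
  proof (rule seq_norm_leI)
    fix \<alpha> :: "'n \<Rightarrow> nat"
    define n where "n = N (mlen \<alpha>) / fact (mlen \<alpha>)"
    have n: "n > 0" using N by (simp add: n_def)
    have "ereal (\<bar>b \<alpha>\<bar> / (h ^ mlen \<alpha> * n)) \<le> seq_norm N h b"
      unfolding seq_norm_def n_def by (intro SUP_upper) auto
    then have "\<bar>b \<alpha>\<bar> / (h ^ mlen \<alpha> * n) \<le> C" using C by (meson ereal_less_eq(3) order_trans)
    moreover have Hh: "h ^ mlen \<alpha> \<le> H ^ mlen \<alpha>" "1 \<le> H ^ mlen \<alpha>" "0 < h ^ mlen \<alpha>"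
      using h by (auto simp: H_def intro!: power_mono one_le_power)
    then have "\<bar>b \<alpha>\<bar> / (H ^ mlen \<alpha> * n) \<le> \<bar>b \<alpha>\<bar> / (h ^ mlen \<alpha> * n)"
      using n by (intro divide_left_mono mult_right_mono mult_pos_pos) auto
    moreover have "c * n / (H ^ mlen \<alpha> * n) \<le> c"
    proof -
      have "c * 1 \<le> c * H ^ mlen \<alpha>"
        using Hh c by (intro mult_left_mono) auto
      then show ?thesis
        using Hh n by (simp add: divide_le_eq)
    qed
    moreover have "\<bar>b \<alpha> + c * n\<bar> / (H ^ mlen \<alpha> * n) \<le> (\<bar>b \<alpha>\<bar> + c * n) / (H ^ mlen \<alpha> * n)"
      using n c Hh by (intro divide_right_mono) (auto intro: order_trans[OF abs_triangle_ineq])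
    ultimately show "\<bar>b \<alpha> + c * (N (mlen \<alpha>) / fact (mlen \<alpha>))\<bar> / (H ^ mlen \<alpha> * (N (mlen \<alpha>) / fact (mlen \<alpha>))) \<le> max C 0 + c"
      unfolding n_def[symmetric] by (simp add: add_divide_distrib)
  qed
  then have "seq_norm N H (\<lambda>\<alpha>. b \<alpha> + c * (N (mlen \<alpha>) / fact (mlen \<alpha>))) < \<infinity>"
    by (rule order_le_less_trans) simp
  moreover have "H > 0" by (simp add: H_def)
  ultimately show ?thesis unfolding Lambda_R_def by blast
qed

lemma dense_in_Lambda_R_mono:
  assumes "dense_in_Lambda_R N D" "D \<subseteq> D'" "D' \<subseteq> Lambda_R N"
  shows "dense_in_Lambda_R N D'"
  using assms unfolding dense_in_Lambda_R_def by blast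

theorem mainTheorem6:
  fixes M N :: "nat \<Rightarrow> real"
  assumes "weight_seq M" and "quasianalytic M"
    and "weight_seq N" and "quasianalytic N"
    and "(SUP k\<in>{0<..}. ereal (root k (N k / fact k))) = \<infinity>"
  shows "dense_in_Lambda_R N (Lambda_R N - (jet_germs_Roumieu M :: (('n::finite \<Rightarrow> nat) \<Rightarrow> real) set))
       \<and> dense_in_Lambda_R N (Lambda_R N - (jet_germs_Beurling M :: (('n::finite \<Rightarrow> nat) \<Rightarrow> real) set))"
proof -
  have N: "N p > 0" for p using assms(3) by (simp add: weight_seq_def)
  let ?J = "jet_germs_Roumieu M :: (('n \<Rightarrow> nat) \<Rightarrow> real) set"
  let ?d = "\<lambda>c (\<alpha> :: 'n \<Rightarrow> nat). c * (N (mlen \<alpha>) / fact (mlen \<alpha>))"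
  have outside: "(\<lambda>\<alpha>. b \<alpha> + ?d c \<alpha>) \<notin> ?J" if b: "b \<in> ?J" and c: "c > 0" for b c
  proof
    assume "(\<lambda>\<alpha>. b \<alpha> + ?d c \<alpha>) \<in> ?J"
    then obtain g l where g: "g \<in> E_Roumieu M (cube l :: (real^'n) set)" "l > 0" "(\<lambda>\<alpha>. b \<alpha> + ?d c \<alpha>) = jet g"
      unfolding jet_germs_Roumieu_def by blast
    obtain f k where f: "f \<in> E_Roumieu M (cube k :: (real^'n) set)" "k > 0" "b = jet f"
      using b unfolding jet_germs_Roumieu_def by blast
    \<comment> \<open>Any coordinate will do: the perturbation is positive at every multi-index, in
      particular along each axis.\<close>
    fix i :: 'n
    have "jet g (\<lambda>j. if j = i then m else 0) - jet f (\<lambda>j. if j = i then m else 0) = c * (N m / fact m)" for m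
      using f(3) fun_cong[OF g(3), of "\<lambda>j. if j = i then m else 0"] by (simp add: mlen_axis)
    moreover have "c * (N m / fact m) > 0" for m using c N by simp
    ultimately obtain a C where a: "a > 0" "\<And>m. c * (N m / fact m) * a ^ m \<le> C"
      using jet_difference_bounded[OF assms(1,2) f(1,2) g(1,2), of i "\<lambda>m. c * (N m / fact m)"] by blast
    have "N m / fact m * a ^ m \<le> C / c" for m
      using a(2)[of m] c by (simp add: field_simps)
    then have "(SUP k\<in>{0<..}. ereal (root k (N k / fact k))) < \<infinity>"
      using a(1) N by (intro SUP_root_finite_of_geometric_bound) auto
    then show False using assms(5) by simp
  qed
  have dense: "dense_in_Lambda_R N (Lambda_R N - ?J)"
    unfolding dense_in_Lambda_R_def
  proof (intro conjI ballI allI impI)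
    fix b :: "('n \<Rightarrow> nat) \<Rightarrow> real" and U :: "(('n \<Rightarrow> nat) \<Rightarrow> real) set"
    assume b: "b \<in> Lambda_R N" and U: "LB_zero_nbhd N U"
    obtain \<epsilon> where \<epsilon>: "\<epsilon> > 0" "\<And>u. seq_norm N 1 u < ereal \<epsilon> \<Longrightarrow> u \<in> U"
      using U unfolding LB_zero_nbhd_def by (metis zero_less_one)
    \<comment> \<open>In the step with \<open>h = 1\<close> the perturbation with
      \<open>c = 1\<close> has all weighted quotients equal to 1. The value \<open>c = 0\<close> is
      included to get the zero sequence into \<open>U\<close> when \<open>b\<close> itself is
      outside the image.\<close>
    have small: "?d c \<in> U" if "0 \<le> c" "c < \<epsilon>" for c
    proof -
      have "seq_norm N 1 (?d c) \<le> ereal c"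
        using that N by (intro seq_norm_leI) (simp add: abs_mult less_imp_le)
      then show ?thesis using \<epsilon>(2)[of "?d c"] that by (metis less_ereal.simps(1) order_le_less_trans)
    qed
    show "\<exists>d\<in>Lambda_R N - ?J. (\<lambda>\<alpha>. d \<alpha> - b \<alpha>) \<in> U"
    proof (cases "b \<in> ?J")
      case False
      then show ?thesis using b small[of 0] \<epsilon>(1) by (intro bexI[of _ b]) auto
    next
      case True
      then show ?thesis
        using outside[OF True, of "\<epsilon> / 2"] Lambda_R_add_multiple[OF N b, of "\<epsilon> / 2"] small[of "\<epsilon> / 2"] \<epsilon>(1)
        by (intro bexI[of _ "\<lambda>\<alpha>. b \<alpha> + ?d (\<epsilon> / 2) \<alpha>"]) auto
    qed
  qed auto
  moreover have "dense_in_Lambda_R N (Lambda_R N - (jet_germs_Beurling M :: (('n \<Rightarrow> nat) \<Rightarrow> real) set))"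
    using jet_germs_Beurling_subset_Roumieu by (intro dense_in_Lambda_R_mono[OF dense]) blast+
  ultimately show ?thesis by blast
qed

end
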